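(* Let $\mathscr C$ be a class of graphs. Then $\mathscr C$ has bounded twin-width if and only if the class $\mathrm{svm}_1(\mathscr C)$ of all depth-$1$ vertex minors of graphs in $\mathscr C$ has bounded twin-width.
   Context: Graphs are finite and simple. The local complementation $G\ast v$ complements adjacency between every pair of distinct neighbours of $v$; for an independent set $I$ of $G$, $G\ast I$ is the successive local complementation of all vertices of $I$. A depth-$1$ vertex minor of $G$ is an induced subgraph of $G\ast I$ for some independent set $I$ of $G$. Twin-width: a trigraph has black edges and red edges; contracting two vertices $u,v$ replaces them by a single vertex $w$ such that $wx$ is black if $x$ was black-adjacent to both, non-adjacent if non-adjacent to both, and red otherwise. A graph has twin-width at most $d$ if there is a sequence of contractions reducing it (viewed as a trigraph with only black edges) to a single vertex such that every intermediate trigraph has maximum red degree at most $d$. A class has bounded twin-width if some $d$ bounds the twin-width of all its members. *)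

theory Defs
  imports "Graph_Theory.Graph_Theory"
begin

text \<open>
  A finite simple graph is a \<^locale>\<open>pair_graph\<close>: finite, loop-free, with a symmetric set of arcs;
  an edge \<open>xy\<close> is the pair of arcs \<open>(x, y)\<close> and \<open>(y, x)\<close>.  The graph without vertices is allowed.
\<close>

section \<open>Depth-1 vertex minors\<close>

definition local_complement :: "'a pair_pre_digraph \<Rightarrow> 'a \<Rightarrow> 'a pair_pre_digraph" where
  "local_complement G v =
     \<lparr> pverts = pverts G,
       parcs = {(x, y). if (v, x) \<in> parcs G \<and> (v, y) \<in> parcs G \<and> x \<noteq> y
                        then (x, y) \<notin> parcs G else (x, y) \<in> parcs G} \<rparr>"

definition independent_set :: "'a pair_pre_digraph \<Rightarrow> 'a set \<Rightarrow> bool" where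
  "independent_set G I \<longleftrightarrow> I \<subseteq> pverts G \<and> (\<forall>x\<in>I. \<forall>y\<in>I. (x, y) \<notin> parcs G)"

text \<open>
  For independent \<open>I\<close> the result of complementing at all vertices of \<open>I\<close> does not depend on
  the enumeration \<open>vs\<close> of \<open>I\<close>; see \<open>local_complements_order_independent\<close> below.
\<close>
definition depth1_vertex_minor :: "'a pair_pre_digraph \<Rightarrow> 'a pair_pre_digraph \<Rightarrow> bool" where
  "depth1_vertex_minor H G \<longleftrightarrow>
     (\<exists>I vs. independent_set G I \<and> distinct vs \<and> set vs = I \<and>
       induced_subgraph (with_proj H) (with_proj (foldl local_complement G vs)))"

definition svm1 :: "'a pair_pre_digraph set \<Rightarrow> 'a pair_pre_digraph set" where
  "svm1 C = {H. \<exists>G\<in>C. depth1_vertex_minor H G}"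

section \<open>Twin-width\<close>

record 'a trigraph =
  tverts :: "'a set"
  tblack :: "'a rel"
  tred :: "'a rel"

definition trigraph_of :: "'a pair_pre_digraph \<Rightarrow> 'a trigraph" where
  "trigraph_of G = \<lparr> tverts = pverts G, tblack = parcs G, tred = {} \<rparr>"

definition contract :: "'a trigraph \<Rightarrow> 'a \<Rightarrow> 'a \<Rightarrow> 'a \<Rightarrow> 'a trigraph" where
  "contract T u v w =
     (let R = tverts T - {u, v};
          B = {x \<in> R. (u, x) \<in> tblack T \<and> (v, x) \<in> tblack T};
          N = {x \<in> R. (u, x) \<notin> tblack T \<union> tred T \<and> (v, x) \<notin> tblack T \<union> tred T};
          D = R - B - N
      in \<lparr> tverts = insert w R,
           tblack = (tblack T \<inter> R \<times> R) \<union> {w} \<times> B \<union> B \<times> {w},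
           tred = (tred T \<inter> R \<times> R) \<union> {w} \<times> D \<union> D \<times> {w} \<rparr>)"

text \<open>
  The vertex \<open>w\<close> replacing \<open>u\<close> and \<open>v\<close> may be any element of the vertex type that is not one of
  the remaining vertices.  Reusing \<open>u\<close> or \<open>v\<close> is allowed, so that contractions also exist when
  the vertex type has no fresh elements.
\<close>
definition contraction_step :: "'a trigraph \<Rightarrow> 'a trigraph \<Rightarrow> bool" where
  "contraction_step T T' \<longleftrightarrow>
     (\<exists>u\<in>tverts T. \<exists>v\<in>tverts T. \<exists>w. u \<noteq> v \<and> w \<notin> tverts T - {u, v} \<and> T' = contract T u v w)"

definition red_degree :: "'a trigraph \<Rightarrow> 'a \<Rightarrow> nat" where
  "red_degree T x = card {y. (x, y) \<in> tred T}"

text \<open>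
  The graph without vertices cannot be reduced to a single vertex; by convention it has
  twin-width at most \<open>d\<close> for every \<open>d\<close>.
\<close>
definition twin_width_le :: "'a pair_pre_digraph \<Rightarrow> nat \<Rightarrow> bool" where
  "twin_width_le G d \<longleftrightarrow>
     pverts G = {} \<or>
     (\<exists>n T. T 0 = trigraph_of G \<and> (\<forall>i<n. contraction_step (T i) (T (Suc i))) \<and>
        card (tverts (T n)) = 1 \<and>
        (\<forall>i\<le>n. \<forall>x\<in>tverts (T i). red_degree (T i) x \<le> d))"

definition bounded_twin_width :: "'a pair_pre_digraph set \<Rightarrow> bool" where
  "bounded_twin_width C \<longleftrightarrow> (\<exists>d. \<forall>G\<in>C. twin_width_le G d)"

section \<open>Well-definedness of the definitions\<close>

lemma pverts_local_complement [simp]: "pverts (local_complement G v) = pverts G"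
  by (simp add: local_complement_def)

lemma pair_graph_iff:
  "pair_graph G \<longleftrightarrow> finite (pverts G) \<and> parcs G \<subseteq> pverts G \<times> pverts G \<and> sym (parcs G) \<and>
     irrefl (parcs G)"
proof
  assume "pair_graph G"
  then interpret pair_graph G .
  show "finite (pverts G) \<and> parcs G \<subseteq> pverts G \<times> pverts G \<and> sym (parcs G) \<and> irrefl (parcs G)"
    using in_arcsD1 in_arcsD2 pair_finite_verts no_loops'
    by (auto simp: irrefl_def intro!: symI dest: arcs_symmetric) blast
next
  assume *: "finite (pverts G) \<and> parcs G \<subseteq> pverts G \<times> pverts G \<and> sym (parcs G) \<and>
    irrefl (parcs G)"
  then have "finite (parcs G)"
    using finite_subset by blast
  with * show "pair_graph G"
    by unfold_locales (auto simp: symmetric_def irrefl_def)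
qed

lemma pair_graph_local_complement:
  assumes "pair_graph G"
  shows "pair_graph (local_complement G v)"
  using assms unfolding pair_graph_iff
  by (auto simp: local_complement_def sym_def irrefl_def split: if_splits)

lemma pair_graph_local_complements:
  assumes "pair_graph G"
  shows "pair_graph (foldl local_complement G vs)"
  using assms by (induction vs arbitrary: G) (auto intro: pair_graph_local_complement)

lemma local_complements_parcs:
  assumes "pair_graph G" "independent_set G (set vs)" "distinct vs"
  shows "pverts (foldl local_complement G vs) = pverts G \<and>
    (\<forall>x y. (x, y) \<in> parcs (foldl local_complement G vs) \<longleftrightarrow>
      ((x, y) \<in> parcs G \<longleftrightarrow>
       x = y \<or> even (card {v \<in> set vs. (v, x) \<in> parcs G \<and> (v, y) \<in> parcs G})))"
  using assms
proof (induction vs arbitrary: G)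
  case Nil
  then show ?case by (auto simp: pair_graph_iff irrefl_def)
next
  case (Cons a vs)
  let ?G = "local_complement G a"
  have sym: "(x, y) \<in> parcs G \<Longrightarrow> (y, x) \<in> parcs G" for x y
    using Cons.prems(1) by (auto simp: pair_graph_iff sym_def)
  have irr: "(x, x) \<notin> parcs G" for x
    using Cons.prems(1) by (auto simp: pair_graph_iff irrefl_def)
  have nb: "(v, x) \<in> parcs ?G \<longleftrightarrow> (v, x) \<in> parcs G" if "v \<in> set vs" for v x
    using Cons.prems(2) that by (auto simp: independent_set_def local_complement_def)
  have "independent_set ?G (set vs)"
    using Cons.prems(2) nb by (auto simp: independent_set_def)
  then have IH: "pverts (foldl local_complement ?G vs) = pverts ?G \<and>
    (\<forall>x y. (x, y) \<in> parcs (foldl local_complement ?G vs) \<longleftrightarrow>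
      ((x, y) \<in> parcs ?G \<longleftrightarrow>
       x = y \<or> even (card {v \<in> set vs. (v, x) \<in> parcs ?G \<and> (v, y) \<in> parcs ?G})))"
    using Cons.IH[OF pair_graph_local_complement[OF Cons.prems(1)]] Cons.prems(3) by auto
  have eq: "{v \<in> set vs. (v, x) \<in> parcs ?G \<and> (v, y) \<in> parcs ?G} =
    {v \<in> set vs. (v, x) \<in> parcs G \<and> (v, y) \<in> parcs G}" for x y
    using nb by auto
  have card: "card {v \<in> set (a # vs). (v, x) \<in> parcs G \<and> (v, y) \<in> parcs G} =
    (if (a, x) \<in> parcs G \<and> (a, y) \<in> parcs G then Suc else id)
      (card {v \<in> set vs. (v, x) \<in> parcs G \<and> (v, y) \<in> parcs G})" for x y
  proof -
    have "{v \<in> set (a # vs). (v, x) \<in> parcs G \<and> (v, y) \<in> parcs G} =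
      (if (a, x) \<in> parcs G \<and> (a, y) \<in> parcs G then insert a else id)
        {v \<in> set vs. (v, x) \<in> parcs G \<and> (v, y) \<in> parcs G}"
      by auto
    then show ?thesis using Cons.prems(3) by auto
  qed
  have arcs: "(x, y) \<in> parcs ?G \<longleftrightarrow>
    ((x, y) \<in> parcs G \<longleftrightarrow> \<not> ((a, x) \<in> parcs G \<and> (a, y) \<in> parcs G \<and> x \<noteq> y))" for x y
    by (auto simp: local_complement_def)
  show ?case
    unfolding foldl_Cons card using IH[unfolded eq] arcs by auto
qed

lemma local_complements_order_independent:
  assumes "pair_graph G" "independent_set G (set vs)" "distinct vs" "distinct ws"
    and "set vs = set ws"
  shows "foldl local_complement G vs = foldl local_complement G ws"
proof -
  have "pverts (foldl local_complement G vs) = pverts (foldl local_complement G ws)"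
    using local_complements_parcs[of G vs] local_complements_parcs[of G ws] assms by simp
  moreover have "parcs (foldl local_complement G vs) = parcs (foldl local_complement G ws)"
    using local_complements_parcs[of G vs] local_complements_parcs[of G ws] assms by auto
  ultimately show ?thesis by simp
qed

lemma svm1_pair_graph:
  assumes "\<And>G. G \<in> C \<Longrightarrow> pair_graph G" "H \<in> svm1 C"
  shows "pair_graph H"
proof -
  obtain G vs where G: "G \<in> C"
    and "induced_subgraph (with_proj H) (with_proj (foldl local_complement G vs))"
    using assms(2) by (auto simp: svm1_def depth1_vertex_minor_def)
  moreover have "pair_graph (foldl local_complement G vs)"
    using assms(1) G pair_graph_local_complements by blast
  ultimately show ?thesis
    by (auto simp: pair_graph_iff induced_subgraph_def subgraph_def sym_def irrefl_def
        intro: finite_subset)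
qed

end

theory Submission
  imports Defs
begin

text \<open>
  Follow a contraction sequence of \<open>G\<close> as a sequence of coarser and coarser partitions of its
  vertices, and split every part further: two vertices of a part stay together if they have, modulo
  2, equally many neighbours in \<open>I \<inter> Z\<close> for every part \<open>Z\<close>.  Only the parts \<open>Z\<close> that are equal or
  red-adjacent to the given part can distinguish its vertices, so each part splits into at most
  \<open>2 ^ (d + 1)\<close> classes.  The adjacency of \<open>x\<close> and \<open>y\<close> in \<open>G * I\<close> depends on the parity of the number
  of their common neighbours in \<open>I\<close>.  If the parts of \<open>x\<close> and \<open>y\<close> are at red distance greater than 2,
  every part \<open>Z\<close> is homogeneous to one of them, so this parity is determined by the classes of
  \<open>x\<close> and \<open>y\<close>.  The refined partitions coarsen along the sequence, too, and the same bound holds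
  for all partitions between two consecutive ones.
\<close>

section \<open>Quotient trigraphs\<close>

text \<open>A labelling stands for the partition of \<open>S\<close> into its fibres. The codomains
  differ so that vertex labels can be compared with parity labels.\<close>

definition refines_on :: "'a set \<Rightarrow> ('a \<Rightarrow> 'b) \<Rightarrow> ('a \<Rightarrow> 'c) \<Rightarrow> bool" where
  "refines_on S f g \<longleftrightarrow> (\<forall>x\<in>S. \<forall>y\<in>S. f x = f y \<longrightarrow> g x = g y)"

lemma refines_on_trans:
  "refines_on S f g \<Longrightarrow> refines_on S g h \<Longrightarrow> refines_on S f h"
  unfolding refines_on_def by blast

lemma refines_onD: "refines_on S f g \<Longrightarrow> x \<in> S \<Longrightarrow> y \<in> S \<Longrightarrow> f x = f y \<Longrightarrow> g x = g y"
  unfolding refines_on_def by blast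

text \<open>On \<open>A\<close>, \<open>g\<close> factors through \<open>f\<close>: a value of
  \<open>f\<close> determines \<open>g\<close> at any chosen preimage.\<close>

lemma card_image_refines_on:
  assumes "refines_on S f g" "A \<subseteq> S" "finite A"
  shows "card (g ` A) \<le> card (f ` A)"
proof -
  have "g ` A \<subseteq> (\<lambda>p. g (SOME x. x \<in> A \<and> f x = p)) ` f ` A"
  proof (rule subsetI)
    fix q assume "q \<in> g ` A"
    then obtain x where x: "x \<in> A" "q = g x" by blast
    let ?x = "SOME x'. x' \<in> A \<and> f x' = f x"
    have "?x \<in> A \<and> f ?x = f x" by (rule someI[of _ x]) (simp add: x)
    then have "g ?x = q" using assms(1,2) x by (auto simp: refines_on_def)
    then show "q \<in> (\<lambda>p. g (SOME x. x \<in> A \<and> f x = p)) ` f ` A" using x(1) by force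
  qed
  then show ?thesis
    using assms(3) by (meson card_image_le card_mono finite_imageI order_trans)
qed

definition fully_adjacent :: "'a pair_pre_digraph \<Rightarrow> ('a \<Rightarrow> 'b) \<Rightarrow> 'b \<Rightarrow> 'b \<Rightarrow> bool" where
  "fully_adjacent G f p q \<longleftrightarrow>
     (\<forall>x\<in>pverts G. \<forall>y\<in>pverts G. f x = p \<longrightarrow> f y = q \<longrightarrow> (x, y) \<in> parcs G)"

definition fully_nonadjacent :: "'a pair_pre_digraph \<Rightarrow> ('a \<Rightarrow> 'b) \<Rightarrow> 'b \<Rightarrow> 'b \<Rightarrow> bool" where
  "fully_nonadjacent G f p q \<longleftrightarrow>
     (\<forall>x\<in>pverts G. \<forall>y\<in>pverts G. f x = p \<longrightarrow> f y = q \<longrightarrow> (x, y) \<notin> parcs G)"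

text \<open>This is the trigraph reached from \<open>G\<close> by contracting every fibre of
  \<open>f\<close> to a vertex named by its label, in whatever order.\<close>

definition quotient_trigraph :: "'a pair_pre_digraph \<Rightarrow> ('a \<Rightarrow> 'b) \<Rightarrow> 'b trigraph" where
  "quotient_trigraph G f =
     \<lparr> tverts = f ` pverts G,
       tblack = {(p, q). p \<in> f ` pverts G \<and> q \<in> f ` pverts G \<and> p \<noteq> q \<and> fully_adjacent G f p q},
       tred = {(p, q). p \<in> f ` pverts G \<and> q \<in> f ` pverts G \<and> p \<noteq> q \<and>
                 \<not> fully_adjacent G f p q \<and> \<not> fully_nonadjacent G f p q} \<rparr>"

lemma tverts_quotient [simp]: "tverts (quotient_trigraph G f) = f ` pverts G"
  by (simp add: quotient_trigraph_def)

lemma trigraph_of_eq_quotient: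
  assumes "pair_graph G"
  shows "trigraph_of G = quotient_trigraph G id"
  using assms unfolding pair_graph_iff
  by (auto simp: trigraph_of_def quotient_trigraph_def fully_adjacent_def fully_nonadjacent_def
      irrefl_def)

lemma fully_adjacent_sym:
  "sym (parcs G) \<Longrightarrow> fully_adjacent G f p q \<longleftrightarrow> fully_adjacent G f q p"
  by (auto simp: fully_adjacent_def dest: symD)

lemma fully_nonadjacent_sym:
  "sym (parcs G) \<Longrightarrow> fully_nonadjacent G f p q \<longleftrightarrow> fully_nonadjacent G f q p"
  by (auto simp: fully_nonadjacent_def dest: symD)

lemma tred_quotient_sym:
  "sym (parcs G) \<Longrightarrow> (p, q) \<in> tred (quotient_trigraph G f) \<Longrightarrow> (q, p) \<in> tred (quotient_trigraph G f)"
  using fully_adjacent_sym[of G f p q] fully_nonadjacent_sym[of G f p q]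
  by (auto simp: quotient_trigraph_def)

definition merge :: "'a \<Rightarrow> 'a \<Rightarrow> 'a \<Rightarrow> 'a \<Rightarrow> 'a" where
  "merge u v w p = (if p = u \<or> p = v then w else p)"

text \<open>The merged part is complete or anticomplete to another part \<open>q\<close> exactly
  when both \<open>u\<close> and \<open>v\<close> are. The condition on \<open>w\<close> ensures
  that no third part already bears this label.\<close>

lemma contract_quotient:
  assumes sym: "sym (parcs G)"
    and u: "u \<in> f ` pverts G" and v: "v \<in> f ` pverts G" and w: "w \<notin> f ` pverts G - {u, v}"
  shows "contract (quotient_trigraph G f) u v w = quotient_trigraph G (merge u v w \<circ> f)"
proof -
  let ?f = "merge u v w \<circ> f"
  define R where "R = f ` pverts G - {u, v}"
  have wR: "w \<notin> R" using w by (simp add: R_def)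
  have eqR: "?f x = p \<longleftrightarrow> f x = p" if "p \<in> R" for x p
    using that wR by (auto simp: merge_def R_def)
  have eqw: "?f x = w \<longleftrightarrow> f x = u \<or> f x = v" if "x \<in> pverts G" for x
    using that w by (auto simp: merge_def)
  have im: "?f ` pverts G = insert w R"
    using u by (auto simp: merge_def R_def image_iff)
  have adjR: "fully_adjacent G ?f p q \<longleftrightarrow> fully_adjacent G f p q"
    and nonR: "fully_nonadjacent G ?f p q \<longleftrightarrow> fully_nonadjacent G f p q"
    if "p \<in> R" "q \<in> R" for p q
    unfolding fully_adjacent_def fully_nonadjacent_def eqR[OF that(1)] eqR[OF that(2)] by simp_all
  have adjw: "fully_adjacent G ?f w q \<longleftrightarrow> fully_adjacent G f u q \<and> fully_adjacent G f v q"
    and nonw: "fully_nonadjacent G ?f w q \<longleftrightarrow> fully_nonadjacent G f u q \<and> fully_nonadjacent G f v q"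
    if "q \<in> R" for q
    unfolding fully_adjacent_def fully_nonadjacent_def eqR[OF that] using eqw by auto
  have adjw': "fully_adjacent G ?f q w \<longleftrightarrow> fully_adjacent G f u q \<and> fully_adjacent G f v q"
    and nonw': "fully_nonadjacent G ?f q w \<longleftrightarrow> fully_nonadjacent G f u q \<and> fully_nonadjacent G f v q"
    if "q \<in> R" for q
    using adjw[OF that] nonw[OF that] fully_adjacent_sym[OF sym, of ?f w q]
      fully_nonadjacent_sym[OF sym, of ?f w q] by simp_all
  let ?T = "quotient_trigraph G f"
  \<comment> \<open>Parts are nonempty, so complete and anticomplete exclude each other, and the
    absence of both colours means anticomplete.\<close>
  have black: "(p, q) \<in> tblack ?T \<longleftrightarrow> fully_adjacent G f p q"
    and white: "(p, q) \<notin> tblack ?T \<union> tred ?T \<longleftrightarrow> fully_nonadjacent G f p q"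
    if "p \<in> f ` pverts G" "q \<in> R" "p \<noteq> q" for p q
    using that by (auto simp: R_def quotient_trigraph_def fully_adjacent_def fully_nonadjacent_def)
  define B where "B = {x \<in> R. (u, x) \<in> tblack ?T \<and> (v, x) \<in> tblack ?T}"
  define N where "N = {x \<in> R. (u, x) \<notin> tblack ?T \<union> tred ?T \<and> (v, x) \<notin> tblack ?T \<union> tred ?T}"
  have ne: "u \<noteq> x" "v \<noteq> x" if "x \<in> R" for x using that by (auto simp: R_def)
  have B: "x \<in> B \<longleftrightarrow> x \<in> R \<and> fully_adjacent G ?f w x" for x
    unfolding B_def using black[OF u] black[OF v] adjw ne by blast
  have N: "x \<in> N \<longleftrightarrow> x \<in> R \<and> fully_nonadjacent G ?f w x" for x
    unfolding N_def mem_Collect_eq using white[OF u] white[OF v] nonw ne by blast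
  have con: "contract ?T u v w = \<lparr> tverts = insert w R,
           tblack = (tblack ?T \<inter> R \<times> R) \<union> {w} \<times> B \<union> B \<times> {w},
           tred = (tred ?T \<inter> R \<times> R) \<union> {w} \<times> (R - B - N) \<union> (R - B - N) \<times> {w} \<rparr>"
    unfolding contract_def Let_def B_def N_def R_def by simp
  have RV: "R \<subseteq> f ` pverts G" by (auto simp: R_def)
  have "(p, q) \<in> tblack (contract ?T u v w) \<longleftrightarrow> (p, q) \<in> tblack (quotient_trigraph G ?f)" for p q
    unfolding con unfolding quotient_trigraph_def im using wR RV
    by (auto simp: B adjR adjw adjw')
  moreover have "(p, q) \<in> tred (contract ?T u v w) \<longleftrightarrow> (p, q) \<in> tred (quotient_trigraph G ?f)" for p q
    unfolding con unfolding quotient_trigraph_def im using wR RV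
    by (auto simp: B N adjR adjw adjw' nonR nonw nonw')
  moreover have "tverts (contract ?T u v w) = tverts (quotient_trigraph G ?f)"
    unfolding con using im by simp
  ultimately show ?thesis
    by (intro trigraph.equality set_eqI) auto
qed

section \<open>Contraction sequences from coarsening partitions\<close>

definition red_bounded :: "nat \<Rightarrow> 'a trigraph \<Rightarrow> bool" where
  "red_bounded d T \<longleftrightarrow> (\<forall>x\<in>tverts T. red_degree T x \<le> d)"

text \<open>Checking the result of each step suffices for sequences from
  \<open>trigraph_of G\<close>, which has no red arcs.\<close>

definition bounded_step :: "nat \<Rightarrow> 'a trigraph \<Rightarrow> 'a trigraph \<Rightarrow> bool" where
  "bounded_step d T T' \<longleftrightarrow> contraction_step T T' \<and> red_bounded d T'"

lemma red_bounded_trigraph_of: "red_bounded d (trigraph_of G)"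
  by (simp add: red_bounded_def red_degree_def trigraph_of_def)

lemma twin_width_leI:
  assumes "(bounded_step d)\<^sup>*\<^sup>* (trigraph_of G) T" "card (tverts T) = 1"
  shows "twin_width_le G d"
proof -
  obtain n F where F: "F 0 = trigraph_of G" "F n = T"
    and step: "\<And>i. i < n \<Longrightarrow> bounded_step d (F i) (F (Suc i))"
    using rtranclp_imp_relpowp[OF assms(1)] unfolding relpowp_fun_conv by blast
  have "red_bounded d (F i)" if "i \<le> n" for i
    using that step F(1) red_bounded_trigraph_of
    by (cases i) (auto simp: bounded_step_def)
  then show ?thesis
    unfolding twin_width_le_def using F assms(2) step
    by (auto simp: bounded_step_def red_bounded_def intro!: disjI2 exI[of _ n] exI[of _ F])
qed

text \<open>While \<open>f\<close> is strictly finer than \<open>g\<close>, two of its parts lie in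
  one part of \<open>g\<close>; merging them gives fewer parts and still refines \<open>g\<close>.
  The final \<open>h\<close> has the fibres of \<open>g\<close>, but labels in the vertex type, as
  contractions require.\<close>

lemma coarsen_by_contractions:
  fixes G :: "'a pair_pre_digraph" and f :: "'a \<Rightarrow> 'a"
  assumes "pair_graph G" "refines_on (pverts G) f g"
    and "\<And>h :: 'a \<Rightarrow> 'a. refines_on (pverts G) f h \<Longrightarrow> refines_on (pverts G) h g \<Longrightarrow>
           red_bounded d (quotient_trigraph G h)"
  obtains h :: "'a \<Rightarrow> 'a"
  where "(bounded_step d)\<^sup>*\<^sup>* (quotient_trigraph G f) (quotient_trigraph G h)"
    and "refines_on (pverts G) h g" "refines_on (pverts G) g h"
proof -
  have "\<exists>h :: 'a \<Rightarrow> 'a. (bounded_step d)\<^sup>*\<^sup>* (quotient_trigraph G f) (quotient_trigraph G h) \<and>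
      refines_on (pverts G) h g \<and> refines_on (pverts G) g h"
    using assms(2,3)
  proof (induction "card (f ` pverts G)" arbitrary: f rule: less_induct)
    case less
    show ?case
    proof (cases "refines_on (pverts G) g f")
      case True
      then show ?thesis using less.prems(1) by blast
    next
      case False
      then obtain x y where x: "x \<in> pverts G" and y: "y \<in> pverts G"
        and eq: "g x = g y" and ne: "f x \<noteq> f y"
        unfolding refines_on_def by blast
      \<comment> \<open>Reusing the label \<open>f x\<close> avoids fresh vertices; the label
        \<open>f y\<close> disappears, so the number of parts drops.\<close>
      define f' where "f' = merge (f x) (f y) (f x) \<circ> f"
      have ff': "refines_on (pverts G) f f'"
        by (auto simp: refines_on_def f'_def)
      have f'g: "refines_on (pverts G) f' g"
        unfolding refines_on_def
      proof (intro ballI impI)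
        fix a b assume a: "a \<in> pverts G" and b: "b \<in> pverts G" and "f' a = f' b"
        then have "f a = f b \<or> (f a = f x \<or> f a = f y) \<and> (f b = f x \<or> f b = f y)"
          by (auto simp: f'_def merge_def split: if_splits)
        then show "g a = g b"
          using refines_onD[OF less.prems(1)] a b x y eq by metis
      qed
      have "f' ` pverts G \<subseteq> f ` pverts G - {f y}"
        using x ne by (auto simp: f'_def merge_def)
      then have "f' ` pverts G \<subset> f ` pverts G" using y by blast
      then have card: "card (f' ` pverts G) < card (f ` pverts G)"
        using assms(1) by (intro psubset_card_mono) (auto simp: pair_graph_iff)
      obtain h :: "'a \<Rightarrow> 'a"
        where h: "(bounded_step d)\<^sup>*\<^sup>* (quotient_trigraph G f') (quotient_trigraph G h)"
          "refines_on (pverts G) h g" "refines_on (pverts G) g h"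
        using less.hyps[OF card f'g] less.prems(2) refines_on_trans[OF ff'] by blast
      have "quotient_trigraph G f' = contract (quotient_trigraph G f) (f x) (f y) (f x)"
        unfolding f'_def using assms(1) x y
        by (intro contract_quotient[symmetric]) (auto simp: pair_graph_iff)
      then have "contraction_step (quotient_trigraph G f) (quotient_trigraph G f')"
        unfolding contraction_step_def using x y ne
        by (intro bexI[of _ "f x"] bexI[of _ "f y"] exI[of _ "f x"]) auto
      then have "bounded_step d (quotient_trigraph G f) (quotient_trigraph G f')"
        using less.prems(2)[OF ff' f'g] by (simp add: bounded_step_def)
      then show ?thesis using h by (meson converse_rtranclp_into_rtranclp)
    qed
  qed
  then show ?thesis using that by blast
qed

section \<open>Refinement by parities of neighbourhoods\<close>

text \<open>Keeping \<open>f x\<close> makes the labels refine \<open>f\<close>. A \<open>z\<close>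
  that labels no vertex of \<open>I\<close> has count 0 and hence the entry
  \<open>True\<close>.\<close>

definition parity_label ::
  "'a pair_pre_digraph \<Rightarrow> 'a set \<Rightarrow> ('a \<Rightarrow> 'b) \<Rightarrow> 'a \<Rightarrow> 'b \<times> ('b \<Rightarrow> bool)" where
  "parity_label G I f x = (f x, \<lambda>z. even (card {v \<in> I. (v, x) \<in> parcs G \<and> f v = z}))"

text \<open>The part \<open>p\<close> itself is included because the quotient records nothing about
  arcs inside a part.\<close>

definition near :: "'a trigraph \<Rightarrow> 'a \<Rightarrow> 'a set" where
  "near T p = insert p {q. (p, q) \<in> tred T}"

lemma near_sym:
  "sym (parcs G) \<Longrightarrow> q \<in> near (quotient_trigraph G f) p \<Longrightarrow> p \<in> near (quotient_trigraph G f) q"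
  using tred_quotient_sym by (fastforce simp: near_def)

lemma homogeneous_outside_near:
  assumes "x \<in> pverts G" "y \<in> pverts G" "x' \<in> pverts G" "y' \<in> pverts G"
    and "f x = f x'" "f y = f y'" "f y \<notin> near (quotient_trigraph G f) (f x)"
  shows "(x, y) \<in> parcs G \<longleftrightarrow> (x', y') \<in> parcs G"
  using assms unfolding near_def quotient_trigraph_def fully_adjacent_def fully_nonadjacent_def
  by auto

lemma finite_tred_quotient:
  assumes "finite (pverts G)"
  shows "finite {q. (p, q) \<in> tred (quotient_trigraph G f)}"
  by (rule finite_subset[of _ "f ` pverts G"]) (auto simp: quotient_trigraph_def assms)

lemma near_bound:
  assumes "finite (pverts G)" "red_bounded d (quotient_trigraph G f)"
  shows "finite (near (quotient_trigraph G f) p)" "card (near (quotient_trigraph G f) p) \<le> Suc d"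
proof -
  let ?T = "quotient_trigraph G f"
  show "finite (near ?T p)" using finite_tred_quotient[OF assms(1)] by (simp add: near_def)
  have "card {q. (p, q) \<in> tred ?T} \<le> d"
  \<comment> \<open>The degree bound speaks only of actual parts; any other \<open>p\<close> has no
    red arcs.\<close>
  proof (cases "p \<in> f ` pverts G")
    case True
    then show ?thesis using assms(2) by (auto simp: red_bounded_def red_degree_def)
  next
    case False
    then have "{q. (p, q) \<in> tred ?T} = {}" by (auto simp: quotient_trigraph_def)
    then show ?thesis by (metis card.empty le0)
  qed
  then show "card (near ?T p) \<le> Suc d"
    unfolding near_def using card_insert_le_m1[of "Suc d" "{q. (p, q) \<in> tred ?T}" p] by simp
qed

text \<open>The neighbours in a coarser part are counted by summing over the finer parts inside it,
  and the parity of a sum depends only on the parities of its terms.\<close>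

lemma parity_label_refines_merge:
  assumes "finite I"
  shows "refines_on S (parity_label G I f) (parity_label G I (m \<circ> f))"
  unfolding refines_on_def
proof (intro ballI impI)
  fix x y assume eq: "parity_label G I f x = parity_label G I f y"
  have split: "even (card {v \<in> I. (v, x) \<in> parcs G \<and> m (f v) = z}) \<longleftrightarrow>
      even (card {q \<in> f ` I. m q = z \<and> odd (card {v \<in> I. (v, x) \<in> parcs G \<and> f v = q})})" for x z
  proof -
    let ?A = "\<lambda>q. {v \<in> I. (v, x) \<in> parcs G \<and> f v = q}"
    have "{v \<in> I. (v, x) \<in> parcs G \<and> m (f v) = z} = (\<Union>q\<in>{q \<in> f ` I. m q = z}. ?A q)"
      by auto
    moreover have "card (\<Union>q\<in>{q \<in> f ` I. m q = z}. ?A q) = (\<Sum>q\<in>{q \<in> f ` I. m q = z}. card (?A q))"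
      using assms by (intro card_UN_disjoint) auto
    ultimately show ?thesis using assms by (simp add: even_sum_iff conj_assoc)
  qed
  show "parity_label G I (m \<circ> f) x = parity_label G I (m \<circ> f) y"
    using eq unfolding parity_label_def by (auto simp: split fun_eq_iff)
qed

text \<open>A part \<open>z\<close> outside \<open>near\<close> of \<open>p\<close> is homogeneous
  to \<open>p\<close>, so all vertices of \<open>p\<close> have the same neighbours in it. A label
  over \<open>p\<close> is therefore determined by its entries on at most \<open>Suc d\<close>
  parts.\<close>

lemma card_parity_labels:
  assumes "finite (pverts G)" "I \<subseteq> pverts G" "S \<subseteq> pverts G"
    and bound: "red_bounded d (quotient_trigraph G f)" and sym: "sym (parcs G)"
  shows "card (parity_label G I f ` {x \<in> S. f x = p}) \<le> 2 ^ Suc d"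
proof -
  let ?N = "near (quotient_trigraph G f) p"
  let ?L = "parity_label G I f ` {x \<in> S. f x = p}"
  have "inj_on (\<lambda>l. {z \<in> ?N. snd l z}) ?L"
  proof (rule inj_onI)
    fix l l' assume "l \<in> ?L" "l' \<in> ?L" and eq: "{z \<in> ?N. snd l z} = {z \<in> ?N. snd l' z}"
    then obtain x y where x: "x \<in> S" "f x = p" "l = parity_label G I f x"
      and y: "y \<in> S" "f y = p" "l' = parity_label G I f y" by blast
    have "snd l z \<longleftrightarrow> snd l' z" for z
    proof (cases "z \<in> ?N")
      case True
      then show ?thesis using eq by blast
    next
      case False
      then have "p \<notin> near (quotient_trigraph G f) z" using near_sym[OF sym, of p f z] by blast
      then have "(v, x) \<in> parcs G \<longleftrightarrow> (v, y) \<in> parcs G" if "v \<in> I" "f v = z" for v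
        using that assms(2,3) x y by (intro homogeneous_outside_near[of _ _ _ _ _ f]) auto
      then have "{v \<in> I. (v, x) \<in> parcs G \<and> f v = z} = {v \<in> I. (v, y) \<in> parcs G \<and> f v = z}" by blast
      then show ?thesis using x y by (simp add: parity_label_def)
    qed
    then have "snd l = snd l'" by blast
    then show "l = l'" using x y by (simp add: parity_label_def)
  qed
  moreover have "(\<lambda>l. {z \<in> ?N. snd l z}) ` ?L \<subseteq> Pow ?N" by blast
  ultimately have "card ?L \<le> card (Pow ?N)"
    using near_bound(1)[OF assms(1) bound] by (intro card_inj_on_le) auto
  also have "\<dots> \<le> 2 ^ Suc d"
    using near_bound[OF assms(1) bound] by (simp add: card_Pow power_increasing del: power_Suc)
  finally show ?thesis .
qed

section \<open>Parts at red distance at most two\<close>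

definition second_near :: "'a trigraph \<Rightarrow> 'a \<Rightarrow> 'a set" where
  "second_near T p = (\<Union>z\<in>near T p. near T z)"

lemma second_near_bound:
  assumes "finite (pverts G)" "red_bounded d (quotient_trigraph G f)"
  shows "finite (second_near (quotient_trigraph G f) p)"
    and "card (second_near (quotient_trigraph G f) p) \<le> Suc d * Suc d"
proof -
  let ?T = "quotient_trigraph G f"
  show "finite (second_near ?T p)" using near_bound(1)[OF assms] by (simp add: second_near_def)
  have "card (second_near ?T p) \<le> (\<Sum>z\<in>near ?T p. card (near ?T z))"
    unfolding second_near_def by (rule card_UN_le[OF near_bound(1)[OF assms]])
  also have "\<dots> \<le> card (near ?T p) * Suc d"
    using sum_bounded_above[of "near ?T p" "\<lambda>z. card (near ?T z)" "Suc d"] near_bound(2)[OF assms] by simp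
  also have "\<dots> \<le> Suc d * Suc d" using near_bound(2)[OF assms] by (intro mult_le_mono1)
  finally show "card (second_near ?T p) \<le> Suc d * Suc d" .
qed

lemma second_near_sym:
  assumes "sym (parcs G)" "q \<in> second_near (quotient_trigraph G f) p"
  shows "p \<in> second_near (quotient_trigraph G f) q"
proof -
  obtain z where "z \<in> near (quotient_trigraph G f) p" "q \<in> near (quotient_trigraph G f) z"
    using assms(2) by (auto simp: second_near_def)
  then show ?thesis using near_sym[OF assms(1)] unfolding second_near_def by (meson UN_I)
qed

section \<open>Adjacency after complementing at an independent set\<close>

text \<open>For independent \<open>I\<close> this is the formula of
  \<open>local_complements_parcs\<close> for adjacency in \<open>G * I\<close>.\<close>

definition complement_adj :: "'a pair_pre_digraph \<Rightarrow> 'a set \<Rightarrow> 'a \<Rightarrow> 'a \<Rightarrow> bool" where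
  "complement_adj G I x y \<longleftrightarrow>
     ((x, y) \<in> parcs G \<longleftrightarrow> x = y \<or> even (card {v \<in> I. (v, x) \<in> parcs G \<and> (v, y) \<in> parcs G}))"

lemma complement_adj_sym:
  assumes "sym (parcs G)"
  shows "complement_adj G I x y \<longleftrightarrow> complement_adj G I y x"
proof -
  have "(x, y) \<in> parcs G \<longleftrightarrow> (y, x) \<in> parcs G" using assms by (meson symD)
  then show ?thesis by (auto simp: complement_adj_def conj_commute)
qed

text \<open>The common neighbours in \<open>I\<close> are counted part by part. A part not near that
  of \<open>x\<close> is homogeneous to it, so \<open>x\<close> and \<open>x'\<close> have the same
  neighbours there. A part near that of \<open>x\<close> is not near that of \<open>y\<close>, so
  \<open>y\<close> sees all or nothing of it: the count is that of all neighbours of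
  \<open>x\<close> in \<open>I\<close> there, whose parity is in the label, or zero.\<close>

lemma complement_adj_cong_left:
  assumes sym: "sym (parcs G)" and fin: "finite (pverts G)" and I: "I \<subseteq> pverts G"
    and V: "x \<in> pverts G" "x' \<in> pverts G" "y \<in> pverts G"
    and eq: "parity_label G I f x = parity_label G I f x'"
    and far: "f y \<notin> second_near (quotient_trigraph G f) (f x)"
  shows "complement_adj G I x y \<longleftrightarrow> complement_adj G I x' y"
proof -
  let ?T = "quotient_trigraph G f"
  have finI: "finite I" using I fin finite_subset by blast
  have fx: "f x = f x'" using eq by (simp add: parity_label_def)
  have self: "p \<in> near ?T p" for p by (simp add: near_def)
  have far1: "f y \<notin> near ?T (f x)" using far self by (auto simp: second_near_def)
  then have ne: "x \<noteq> y" "x' \<noteq> y" using fx self by metis+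
  have adj: "(x, y) \<in> parcs G \<longleftrightarrow> (x', y) \<in> parcs G"
    using homogeneous_outside_near[OF V(1,3,2,3) fx refl far1] .
  let ?A = "\<lambda>x z. {v \<in> I. ((v, x) \<in> parcs G \<and> (v, y) \<in> parcs G) \<and> f v = z}"
  have par: "even (card (?A x z)) \<longleftrightarrow> even (card (?A x' z))" for z
  proof (cases "z \<in> near ?T (f x)")
    case False
    then have "f x \<notin> near ?T z" using near_sym[OF sym, of "f x" f z] by blast
    then have "(v, x) \<in> parcs G \<longleftrightarrow> (v, x') \<in> parcs G" if "v \<in> I" "f v = z" for v
      using that I V fx by (intro homogeneous_outside_near[of _ _ _ _ _ f]) auto
    then have "?A x z = ?A x' z" by blast
    then show ?thesis by simp
  next
    case True
    then have "f y \<notin> near ?T z" using far by (auto simp: second_near_def)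
    then have hom: "(v, y) \<in> parcs G \<longleftrightarrow> (v', y) \<in> parcs G"
      if "v \<in> I" "f v = z" "v' \<in> I" "f v' = z" for v v'
      using that I V by (intro homogeneous_outside_near[of _ _ _ _ _ f]) auto
    show ?thesis
    proof (cases "\<exists>v\<in>I. f v = z \<and> (v, y) \<in> parcs G")
      case True
      then have "?A a z = {v \<in> I. (v, a) \<in> parcs G \<and> f v = z}" for a using hom by blast
      then show ?thesis using eq by (simp add: parity_label_def fun_eq_iff)
    next
      case False
      then have empty: "?A a z = {}" for a by blast
      show ?thesis by (simp only: empty)
    qed
  qed
  \<comment> \<open>The total parity is that of the number of parts contributing an odd
    count.\<close>
  have "even (card {v \<in> I. (v, a) \<in> parcs G \<and> (v, y) \<in> parcs G}) \<longleftrightarrow>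
      even (card {z \<in> f ` I. odd (card (?A a z))})" for a
  proof -
    have "{v \<in> I. (v, a) \<in> parcs G \<and> (v, y) \<in> parcs G} = (\<Union>z\<in>f ` I. ?A a z)" by auto
    moreover have "card (\<Union>z\<in>f ` I. ?A a z) = (\<Sum>z\<in>f ` I. card (?A a z))"
      using finI by (intro card_UN_disjoint) auto
    ultimately show ?thesis using finI by (simp add: even_sum_iff)
  qed
  then show ?thesis
    unfolding complement_adj_def using adj ne par by simp
qed

text \<open>The arguments are exchanged one at a time, with symmetry of adjacency and of red
  distance for the second.\<close>

lemma complement_adj_cong:
  assumes sym: "sym (parcs G)" and fin: "finite (pverts G)" and I: "I \<subseteq> pverts G"
    and V: "x \<in> pverts G" "x' \<in> pverts G" "y \<in> pverts G" "y' \<in> pverts G"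
    and x: "parity_label G I f x = parity_label G I f x'"
    and y: "parity_label G I f y = parity_label G I f y'"
    and far: "f y \<notin> second_near (quotient_trigraph G f) (f x)"
  shows "complement_adj G I x y \<longleftrightarrow> complement_adj G I x' y'"
proof -
  have fx: "f x = f x'" using x by (simp add: parity_label_def)
  have far': "f x' \<notin> second_near (quotient_trigraph G f) (f y)"
    using far second_near_sym[OF sym, of "f x'" f "f y"] unfolding fx by blast
  have "complement_adj G I x y \<longleftrightarrow> complement_adj G I x' y"
    by (rule complement_adj_cong_left[OF sym fin I V(1,2,3) x far])
  also have "\<dots> \<longleftrightarrow> complement_adj G I y x'" by (rule complement_adj_sym[OF sym])
  also have "\<dots> \<longleftrightarrow> complement_adj G I y' x'"
    by (rule complement_adj_cong_left[OF sym fin I V(3,4,2) y far'])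
  also have "\<dots> \<longleftrightarrow> complement_adj G I x' y'" by (rule complement_adj_sym[OF sym])
  finally show ?thesis .
qed

section \<open>Twin-width of depth-1 vertex minors\<close>

text \<open>A red neighbour of the class of \<open>a\<close> must lie over a part at red distance at
  most two from \<open>f a\<close>, since farther classes are homogeneous to each other. There are
  at most \<open>Suc d * Suc d\<close> such parts, with at most \<open>k\<close> classes
  each.\<close>

lemma red_bounded_refinement:
  assumes G: "pair_graph G" and I: "I \<subseteq> pverts G" and S: "pverts H \<subseteq> pverts G"
    and H: "\<And>x y. x \<in> pverts H \<Longrightarrow> y \<in> pverts H \<Longrightarrow> (x, y) \<in> parcs H \<longleftrightarrow> complement_adj G I x y"
    and bound: "red_bounded d (quotient_trigraph G f)"
    and hf: "refines_on (pverts H) h (parity_label G I f)"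
    and card: "\<And>q. card (h ` {x \<in> pverts H. f x = q}) \<le> k"
  shows "red_bounded (Suc d * Suc d * k) (quotient_trigraph H h)"
  unfolding red_bounded_def
proof
  have fin: "finite (pverts G)" and sym: "sym (parcs G)" using G by (auto simp: pair_graph_iff)
  have finS: "finite (pverts H)" using S fin finite_subset by blast
  let ?T = "quotient_trigraph G f"
  fix p assume "p \<in> tverts (quotient_trigraph H h)"
  then obtain a where a: "a \<in> pverts H" "p = h a" by auto
  let ?N = "second_near ?T (f a)"
  note N = second_near_bound[OF fin bound, of "f a"]
  have "{q. (p, q) \<in> tred (quotient_trigraph H h)} \<subseteq> (\<Union>z\<in>?N. h ` {x \<in> pverts H. f x = z})"
  proof
    fix q assume "q \<in> {q. (p, q) \<in> tred (quotient_trigraph H h)}"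
    then have q: "q \<in> h ` pverts H" "\<not> fully_adjacent H h p q" "\<not> fully_nonadjacent H h p q"
      by (auto simp: quotient_trigraph_def)
    then obtain x y x' y' where xy: "x \<in> pverts H" "y \<in> pverts H" "x' \<in> pverts H" "y' \<in> pverts H"
      "h x = p" "h y = q" "h x' = p" "h y' = q" "(x, y) \<in> parcs H" "(x', y') \<notin> parcs H"
      unfolding fully_adjacent_def fully_nonadjacent_def by blast
    \<comment> \<open>An arc and a non-arc between the same two classes contradict
      \<open>complement_adj_cong\<close> if the parts are far apart.\<close>
    have lx: "parity_label G I f x = parity_label G I f x'"
      and la: "parity_label G I f x = parity_label G I f a"
      and ly: "parity_label G I f y = parity_label G I f y'"
      using xy a by (auto intro: refines_onD[OF hf])
    have "f x = f a" using la by (simp add: parity_label_def)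
    moreover have "f y \<in> second_near ?T (f x)"
    proof (rule ccontr)
      assume "f y \<notin> second_near ?T (f x)"
      from complement_adj_cong[OF sym fin I _ _ _ _ lx ly this] show False
        using xy S H by blast
    qed
    ultimately show "q \<in> (\<Union>z\<in>?N. h ` {x \<in> pverts H. f x = z})" using xy by auto
  qed
  then have "red_degree (quotient_trigraph H h) p \<le> card (\<Union>z\<in>?N. h ` {x \<in> pverts H. f x = z})"
    unfolding red_degree_def using N(1) finS by (intro card_mono) auto
  also have "\<dots> \<le> (\<Sum>z\<in>?N. card (h ` {x \<in> pverts H. f x = z}))" by (rule card_UN_le[OF N(1)])
  also have "\<dots> \<le> card ?N * k"
    using sum_bounded_above[of ?N "\<lambda>z. card (h ` {x \<in> pverts H. f x = z})" k] card by simp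
  also have "\<dots> \<le> Suc d * Suc d * k" using N(2) by (intro mult_le_mono1)
  finally show "red_degree (quotient_trigraph H h) p \<le> Suc d * Suc d * k" .
qed

lemma twin_width_le_complement:
  fixes G H :: "'a pair_pre_digraph"
  assumes G: "pair_graph G" and pH: "pair_graph H" and I: "I \<subseteq> pverts G"
    and S: "pverts H \<subseteq> pverts G"
    and H: "\<And>x y. x \<in> pverts H \<Longrightarrow> y \<in> pverts H \<Longrightarrow> (x, y) \<in> parcs H \<longleftrightarrow> complement_adj G I x y"
    and tw: "twin_width_le G d"
  shows "twin_width_le H (Suc d * Suc d * (2 * 2 ^ Suc d))"
proof (cases "pverts H = {}")
  case True
  then show ?thesis by (simp add: twin_width_le_def)
next
  case False
  let ?S = "pverts H"
  \<comment> \<open>\<open>Suc d * Suc d\<close> bounds the parts at red distance at most two. The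
    factor 2 arises because a part after a contraction joins up to two earlier ones, each with at
    most \<open>2 ^ Suc d\<close> classes.\<close>
  define D where "D = Suc d * Suc d * (2 * 2 ^ Suc d)"
  have fin: "finite (pverts G)" and sym: "sym (parcs G)" using G by (auto simp: pair_graph_iff)
  have finS: "finite ?S" using S fin finite_subset by blast
  have finI: "finite I" using I fin finite_subset by blast
  let ?g = "\<lambda>f :: 'a \<Rightarrow> 'a. parity_label G I f"
  \<comment> \<open>As \<open>H\<close> has a vertex, so has \<open>G\<close>; hence a contraction
    sequence exists.\<close>
  obtain n T where T: "T 0 = trigraph_of G" "card (tverts (T n)) = 1"
    and step: "\<And>i. i < n \<Longrightarrow> contraction_step (T i) (T (Suc i))"
    and deg: "\<And>i. i \<le> n \<Longrightarrow> red_bounded d (T i)"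
    using tw False S unfolding twin_width_le_def red_bounded_def by blast
  \<comment> \<open>Invariant: on \<open>H\<close>, \<open>h\<close> has the fibres of the parity
    labels of \<open>f\<close>, renamed by elements of the vertex type.\<close>
  have "\<exists>f h :: 'a \<Rightarrow> 'a. T i = quotient_trigraph G f \<and>
      (bounded_step D)\<^sup>*\<^sup>* (trigraph_of H) (quotient_trigraph H h) \<and>
      refines_on ?S h (?g f) \<and> refines_on ?S (?g f) h" if "i \<le> n" for i
    using that
  proof (induction i)
    case 0
    have "T 0 = quotient_trigraph G id"
      using T(1) trigraph_of_eq_quotient[OF G] by simp
    moreover have "(bounded_step D)\<^sup>*\<^sup>* (trigraph_of H) (quotient_trigraph H id)"
      using trigraph_of_eq_quotient[OF pH] by simp
    moreover have "refines_on ?S id (?g id)" "refines_on ?S (?g id) id"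
      by (auto simp: refines_on_def parity_label_def)
    ultimately show ?case by blast
  next
    case (Suc i)
    then obtain f h :: "'a \<Rightarrow> 'a" where f: "T i = quotient_trigraph G f"
      and h: "(bounded_step D)\<^sup>*\<^sup>* (trigraph_of H) (quotient_trigraph H h)"
      and hf: "refines_on ?S h (?g f)" "refines_on ?S (?g f) h" by auto
    obtain u v w where uvw: "u \<in> f ` pverts G" "v \<in> f ` pverts G" "w \<notin> f ` pverts G - {u, v}"
      and T': "T (Suc i) = contract (quotient_trigraph G f) u v w"
      using step[of i] Suc.prems f unfolding contraction_step_def by auto
    define f' where "f' = merge u v w \<circ> f"
    have f': "T (Suc i) = quotient_trigraph G f'"
      unfolding T' f'_def by (rule contract_quotient[OF sym uvw])
    have bd: "red_bounded d (quotient_trigraph G f)" "red_bounded d (quotient_trigraph G f')"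
      using deg[of i] deg[of "Suc i"] Suc.prems f f' by auto
    have ref: "refines_on ?S (?g f) (?g f')"
      unfolding f'_def by (rule parity_label_refines_merge[OF finI])
    \<comment> \<open>Intermediate \<open>k\<close> refine the labels of \<open>f'\<close>, so red
      distance is measured in the new trigraph; they coarsen those of \<open>f\<close>, so classes
      are counted over the old parts.\<close>
    have good: "red_bounded D (quotient_trigraph H k)"
      if k: "refines_on ?S h k" "refines_on ?S k (?g f')" for k :: "'a \<Rightarrow> 'a"
      unfolding D_def
    proof (rule red_bounded_refinement[OF G I S H bd(2) k(2)])
      fix q
      let ?A = "\<lambda>p. {x \<in> ?S. f x = p}"
      have le: "card (k ` ?A p) \<le> 2 ^ Suc d" for p
      proof -
        have "card (k ` ?A p) \<le> card (?g f ` ?A p)"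
          using refines_on_trans[OF hf(2) k(1)] finS by (intro card_image_refines_on[of ?S]) auto
        also have "\<dots> \<le> 2 ^ Suc d" by (rule card_parity_labels[OF fin I S bd(1) sym])
        finally show ?thesis .
      qed
      have "\<exists>p p'. {x \<in> ?S. f' x = q} \<subseteq> ?A p \<union> ?A p'"
      proof (cases "q = w")
        case True
        have "{x \<in> ?S. f' x = q} \<subseteq> ?A u \<union> ?A v"
          using S uvw(3) True by (auto simp: f'_def merge_def split: if_splits)
        then show ?thesis by blast
      next
        case False
        then have "{x \<in> ?S. f' x = q} \<subseteq> ?A q \<union> ?A q"
          by (auto simp: f'_def merge_def split: if_splits)
        then show ?thesis by blast
      qed
      then obtain p p' where "{x \<in> ?S. f' x = q} \<subseteq> ?A p \<union> ?A p'" by blast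
      then have "card (k ` {x \<in> ?S. f' x = q}) \<le> card (k ` ?A p \<union> k ` ?A p')"
        using finS by (intro card_mono) auto
      also have "\<dots> \<le> card (k ` ?A p) + card (k ` ?A p')" by (rule card_Un_le)
      also have "\<dots> \<le> 2 * 2 ^ Suc d" using le[of p] le[of p'] by simp
      finally show "card (k ` {x \<in> ?S. f' x = q}) \<le> 2 * 2 ^ Suc d" .
    qed
    obtain h' :: "'a \<Rightarrow> 'a" where
      "(bounded_step D)\<^sup>*\<^sup>* (quotient_trigraph H h) (quotient_trigraph H h')"
      "refines_on ?S h' (?g f')" "refines_on ?S (?g f') h'"
      using coarsen_by_contractions[OF pH refines_on_trans[OF hf(1) ref] good] by blast
    then show ?case using f' h by (meson rtranclp_trans)
  qed
  from this[of n] obtain f h :: "'a \<Rightarrow> 'a" where f: "T n = quotient_trigraph G f"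
    and h: "(bounded_step D)\<^sup>*\<^sup>* (trigraph_of H) (quotient_trigraph H h)"
    and hf: "refines_on ?S (?g f) h" by auto
  obtain p where p: "f ` pverts G = {p}" using T(2) f by (auto simp: card_1_singleton_iff)
  have "card (?g f ` ?S) \<le> 2 ^ Suc d"
  proof -
    have "{x \<in> ?S. f x = p} = ?S" using p S by auto
    then show ?thesis
      using card_parity_labels[OF fin I S _ sym, of d f p] deg[of n] f by simp
  qed
  \<comment> \<open>One part of \<open>G\<close> remains, so at most \<open>2 ^ Suc d\<close>
    classes are left. They can be merged in any order, as their number bounds every red
    degree.\<close>
  have last: "red_bounded D (quotient_trigraph H k)" if k: "refines_on ?S h k" "refines_on ?S k (\<lambda>_. ())" for k :: "'a \<Rightarrow> 'a"
    unfolding red_bounded_def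
  proof
    fix q
    have "red_degree (quotient_trigraph H k) q \<le> card (k ` ?S)"
      unfolding red_degree_def using finS by (intro card_mono) (auto simp: quotient_trigraph_def)
    also have "\<dots> \<le> card (?g f ` ?S)"
      using refines_on_trans[OF hf k(1)] finS by (intro card_image_refines_on[of ?S]) auto
    also have "\<dots> \<le> 2 ^ Suc d" by fact
    also have "\<dots> \<le> D" by (simp add: D_def)
    finally show "red_degree (quotient_trigraph H k) q \<le> D" .
  qed
  have hc: "refines_on ?S h (\<lambda>_. ())" by (simp add: refines_on_def)
  obtain k :: "'a \<Rightarrow> 'a" where
    k: "(bounded_step D)\<^sup>*\<^sup>* (quotient_trigraph H h) (quotient_trigraph H k)"
    and "refines_on ?S k (\<lambda>_. ())" and const: "refines_on ?S (\<lambda>_. ()) k"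
    using last by (rule coarsen_by_contractions[OF pH hc, of D])
  obtain a where "a \<in> ?S" using False by blast
  then have "k ` ?S = {k a}" using const unfolding refines_on_def by blast
  then have "card (tverts (quotient_trigraph H k)) = 1" by simp
  then show ?thesis
    using twin_width_leI[OF rtranclp_trans[OF h k]] by (simp add: D_def)
qed

lemma twin_width_le_depth1_vertex_minor:
  assumes G: "pair_graph G" and HG: "depth1_vertex_minor H G" and tw: "twin_width_le G d"
  shows "twin_width_le H (Suc d * Suc d * (2 * 2 ^ Suc d))"
proof -
  from HG obtain vs where vs: "independent_set G (set vs)" "distinct vs"
    and ind: "induced_subgraph (with_proj H) (with_proj (foldl local_complement G vs))"
    unfolding depth1_vertex_minor_def by blast
  let ?K = "foldl local_complement G vs"
  note K = local_complements_parcs[OF G vs]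
  have S: "pverts H \<subseteq> pverts G"
    using ind K by (auto simp: induced_subgraph_def subgraph_def)
  have arcs: "parcs H = {e \<in> parcs ?K. fst e \<in> pverts H \<and> snd e \<in> pverts H}"
    using ind by (auto simp: induced_subgraph_def)
  have "pair_graph H"
    using svm1_pair_graph[of "{G}" H] G HG by (auto simp: svm1_def)
  then show ?thesis
    using K arcs vs(1) S
    by (intro twin_width_le_complement[OF G _ _ _ _ tw, of H "set vs"])
      (auto simp: complement_adj_def independent_set_def)
qed

text \<open>The empty independent set leaves \<open>G\<close> unchanged.\<close>

lemma depth1_vertex_minor_refl:
  assumes "pair_graph G"
  shows "depth1_vertex_minor G G"
proof -
  interpret pair_graph G by fact
  have "induced_subgraph (with_proj G) (with_proj G)"
    by (rule induced_subgraph_refl)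
  then show ?thesis
    unfolding depth1_vertex_minor_def independent_set_def
    by (intro exI[of _ "{}"] exI[of _ "[]"]) simp
qed

theorem theorem25:
  fixes C :: "'a pair_pre_digraph set"
  assumes "\<And>G. G \<in> C \<Longrightarrow> pair_graph G"
  shows "bounded_twin_width C \<longleftrightarrow> bounded_twin_width (svm1 C)"
proof
  assume "bounded_twin_width C"
  then obtain d where "\<forall>G\<in>C. twin_width_le G d" unfolding bounded_twin_width_def ..
  then have "\<forall>H\<in>svm1 C. twin_width_le H (Suc d * Suc d * (2 * 2 ^ Suc d))"
    using assms twin_width_le_depth1_vertex_minor unfolding svm1_def by blast
  then show "bounded_twin_width (svm1 C)" unfolding bounded_twin_width_def ..
next
  assume "bounded_twin_width (svm1 C)"
  moreover have "C \<subseteq> svm1 C"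
    using assms depth1_vertex_minor_refl unfolding svm1_def by blast
  ultimately show "bounded_twin_width C" unfolding bounded_twin_width_def by blast
qed

end
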